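(* Let $G$ be a tree with vertex set $V(G)=\{x_1,\ldots,x_n\}$ and edge set $E(G)=\{e_1,\ldots,e_{n-1}\}$. Then for every tuple $\mathbf{k}_{n-1}=(k_1,\ldots,k_{n-1})\in\mathbb{N}^{n-1}$, the graph $G(\mathbf{k}_{n-1})$ is vertex decomposable.
   Context: Here $\mathbb{N}=\{0,1,2,\ldots\}$ and all graphs are finite and simple. Construction of $G(\mathbf{k}_t)$: let $G$ be a simple graph with vertex set $\{x_1,\ldots,x_n\}$ and edges $e_1,\ldots,e_t$. For an edge $e=\{x_i,x_j\}$ of $G$ and an integer $p\ge 1$, let $e(p)$ be the graph with vertex set $V(e(p))=\{x_{s,a}: s\in\{i,j\},\ 1\le a\le p\}$ and edge set $E(e(p))=\{\{x_{i,l},x_{j,m}\}: 1\le l,m\le p,\ l+m\le p+1\}$. By convention, $e(0)$ is the graph with vertex set $\{x_{i,1},x_{j,1}\}$ and no edges. For $\mathbf{k}_t=(k_1,\ldots,k_t)\in\mathbb{N}^t$, the graph $G(\mathbf{k}_t)=G(k_1,\ldots,k_t)$ has vertex set $\bigcup_{i=1}^t V(e_i(k_i))$ and edge set $\bigcup_{i=1}^t E(e_i(k_i))$ (vertices with the same label $x_{s,a}$ coming from different edges are the same vertex). Vertex decomposable graphs: for a vertex $x$ of a graph $H$, $N_H(x)$ is the set of vertices adjacent to $x$, and $N_H[x]=N_H(x)\cup\{x\}$. For $K\subset V(H)$, $H\setminus K$ is the induced subgraph on $V(H)\setminus K$. A graph $H$ is (recursively) called vertex decomposable if it has no edges, or there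 is a vertex $x$ of $H$ such that (i) $H\setminus\{x\}$ and $H\setminus N_H[x]$ are vertex decomposable, and (ii) for every independent set $C$ in $H\setminus N_H[x]$ there exists $y\in N_H(x)$ such that $C\cup\{y\}$ is independent in $H\setminus\{x\}$. *)

theory Defs
  imports "HOL-Library.Ramsey"
begin

section \<open>Finite simple graphs\<close>

record 'a graph =
  verts :: "'a set"
  edges :: "'a set set"

definition simple_graph :: "'a graph \<Rightarrow> bool" where
  "simple_graph G \<longleftrightarrow>
     finite (verts G) \<and> (\<forall>e\<in>edges G. e \<subseteq> verts G \<and> card e = 2)"

definition connected_graph :: "'a graph \<Rightarrow> bool" where
  "connected_graph G \<longleftrightarrow>
     verts G \<noteq> {} \<and>
     (\<forall>u\<in>verts G. \<forall>v\<in>verts G. (\<lambda>a b. {a, b} \<in> edges G)\<^sup>*\<^sup>* u v)"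

text \<open>A cycle is the list of its vertices in cyclic order, without repeating the first one.\<close>

definition cycle_in :: "'a graph \<Rightarrow> 'a list \<Rightarrow> bool" where
  "cycle_in G c \<longleftrightarrow>
     3 \<le> length c \<and> distinct c \<and>
     successively (\<lambda>a b. {a, b} \<in> edges G) c \<and> {last c, hd c} \<in> edges G"

definition tree :: "'a graph \<Rightarrow> bool" where
  "tree G \<longleftrightarrow> simple_graph G \<and> connected_graph G \<and> (\<nexists>c. cycle_in G c)"


section \<open>Vertex decomposable graphs\<close>

definition neighbors :: "'a graph \<Rightarrow> 'a \<Rightarrow> 'a set" where
  "neighbors H x = {y \<in> verts H. {x, y} \<in> edges H}"

definition closed_neighbors :: "'a graph \<Rightarrow> 'a \<Rightarrow> 'a set" where
  "closed_neighbors H x = neighbors H x \<union> {x}"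

definition delete_verts :: "'a graph \<Rightarrow> 'a set \<Rightarrow> 'a graph" where
  "delete_verts H K =
     \<lparr>verts = verts H - K, edges = {e \<in> edges H. e \<subseteq> verts H - K}\<rparr>"

text \<open>The constant \<^const>\<open>indep\<close> only says that no two distinct members of the set form an edge.\<close>

definition independent_in :: "'a graph \<Rightarrow> 'a set \<Rightarrow> bool" where
  "independent_in H C \<longleftrightarrow> C \<subseteq> verts H \<and> indep C (edges H)"

text \<open>Both recursive calls are on graphs with fewer vertices, so on finite graphs the least
  fixed point is the only solution of the recursive description.\<close>

inductive vertex_decomposable :: "'a graph \<Rightarrow> bool" where
  no_edges: "edges H = {} \<Longrightarrow> vertex_decomposable H"
| shedding:
    "\<lbrakk>x \<in> verts H;
      vertex_decomposable (delete_verts H {x});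
      vertex_decomposable (delete_verts H (closed_neighbors H x));
      \<forall>C. independent_in (delete_verts H (closed_neighbors H x)) C \<longrightarrow>
        (\<exists>y\<in>neighbors H x. independent_in (delete_verts H {x}) (C \<union> {y}))\<rbrakk>
     \<Longrightarrow> vertex_decomposable H"


section \<open>The graphs \<open>e(p)\<close> and \<open>G(k\<^sub>1, \<dots>, k\<^sub>t)\<close>\<close>

text \<open>The vertex \<open>x\<^sub>s\<^sub>,\<^sub>a\<close> is the pair \<open>(x\<^sub>s, a)\<close>, so copies of the same
  vertex coming from different edges are identified. The formula for the edges is symmetric in the
  two ends of \<open>e\<close>, and it yields the empty set for \<open>p = 0\<close>.\<close>

definition edge_expansion :: "'a set \<Rightarrow> nat \<Rightarrow> ('a \<times> nat) graph" where
  "edge_expansion e p =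
     \<lparr>verts = (if p = 0 then e \<times> {1} else e \<times> {1..p}),
      edges = {{(u, l), (v, m)} | u v l m.
                 e = {u, v} \<and> l \<in> {1..p} \<and> m \<in> {1..p} \<and> l + m \<le> p + 1}\<rparr>"

text \<open>The edges are \<open>e 1, \<dots>, e t\<close>. A tuple in \<open>\<nat>\<^sup>t\<close> is a function of which only the
  values at \<open>1, \<dots>, t\<close> are used.\<close>

definition graph_expansion ::
  "nat \<Rightarrow> (nat \<Rightarrow> 'a set) \<Rightarrow> (nat \<Rightarrow> nat) \<Rightarrow> ('a \<times> nat) graph" where
  "graph_expansion t e k =
     \<lparr>verts = (\<Union>i\<in>{1..t}. verts (edge_expansion (e i) (k i))),
      edges = (\<Union>i\<in>{1..t}. edges (edge_expansion (e i) (k i)))\<rparr>"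

end

theory Submission
  imports Defs
begin

text \<open>
  The deletions in the definition of vertex decomposability turn \<open>G(k)\<close> into some \<open>G(k')\<close> only
  after shifting the second indices and discarding isolated vertices. The induction therefore runs
  over a larger family that is closed under them: the graphs \<open>H\<close> that arise from \<open>G(k)\<close> by
  deleting, in each fibre \<open>{x\<^sub>s\<^sub>,\<^sub>1, x\<^sub>s\<^sub>,\<^sub>2, \<dots>}\<close>, an initial segment.

  Call an edge of \<open>G\<close> alive if some edge of \<open>H\<close> lies above it. The alive edges form a forest, so
  if \<open>H\<close> has an edge at all, then some vertex \<open>u\<close> lies on exactly one alive edge \<open>{u, v}\<close>
  (\<open>acyclic_graph_has_leaf\<close>). Let \<open>p\<close> be the parameter of that edge and \<open>(v, a)\<close> the lowest vertex
  left above \<open>v\<close>. The inequality \<open>l + m \<le> p + 1\<close> makes \<open>(v, a)\<close> the only neighbour of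
  \<open>(u, p + 1 - a)\<close>, because every other neighbour would be a lower vertex above \<open>v\<close>; and that vertex
  is still present, because only initial segments were deleted. A vertex with a pendant neighbour
  is a shedding vertex (a case of \<open>shedding_if_neighbors_subset\<close>). Deleting \<open>(v, a)\<close> removes the
  bottom of one fibre, and its neighbours form initial segments of what is left of the other
  fibres, since \<open>l + a \<le> q + 1\<close> is inherited by smaller \<open>l\<close>. Hence both graphs to which the
  recursion passes belong to the same family.
\<close>

text \<open>The first vertex of a longest path is a leaf: a further neighbour would either prolong the
  path or close a cycle with one of its initial segments.\<close>

lemma acyclic_graph_has_leaf:
  assumes simple: "simple_graph G" and acyclic: "\<nexists>c. cycle_in G c" and "edges G \<noteq> {}"
  obtains u v where "{u, v} \<in> edges G" "\<And>w. {u, w} \<in> edges G \<Longrightarrow> w = v"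
proof -
  define adj where "adj = (\<lambda>a b. {a, b} \<in> edges G)"
  define is_path where
    "is_path p \<longleftrightarrow> distinct p \<and> set p \<subseteq> verts G \<and> successively adj p" for p
  have fin: "finite (verts G)"
    using simple by (simp add: simple_graph_def)
  have edge: "e \<subseteq> verts G" "card e = 2" if "e \<in> edges G" for e
    using simple that by (auto simp: simple_graph_def)
  obtain a b where ab: "{a, b} \<in> edges G" "a \<noteq> b"
    using \<open>edges G \<noteq> {}\<close> edge(2) by (metis card_2_iff ex_in_conv)
  have path_ab: "is_path [a, b]"
    using ab edge(1)[OF ab(1)] by (auto simp: is_path_def adj_def)
  have bound: "length p \<le> card (verts G)" if "is_path p" for p
    using that fin by (metis is_path_def card_mono distinct_card)
  \<comment> \<open>The strict upper bound required for a maximum is one more than the number of vertices.\<close>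
  obtain p where p: "is_path p" and longest: "\<And>q. is_path q \<Longrightarrow> length q \<le> length p"
    using ex_has_greatest_nat[of is_path "[a, b]" length "Suc (card (verts G))"] path_ab bound
    by (metis less_Suc_eq_le)
  from longest[OF path_ab] obtain u v r where p_eq: "p = u # v # r"
    by (cases p rule: remdups_adj.cases) auto
  have "{u, v} \<in> edges G"
    using p by (simp add: p_eq is_path_def adj_def)
  moreover have "w = v" if uw: "{u, w} \<in> edges G" for w
  proof (rule ccontr)
    assume "w \<noteq> v"
    have "w \<noteq> u" using edge(2)[OF uw] by auto
    show False
    proof (cases "w \<in> set p")
      case False
      then have "is_path (w # p)"
        using p uw edge(1)[OF uw]
        by (auto simp: is_path_def adj_def p_eq insert_commute)
      then show False using longest by fastforce
    next
      case True
      then have "w \<in> set r" using \<open>w \<noteq> u\<close> \<open>w \<noteq> v\<close> by (simp add: p_eq)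
      then obtain r1 r2 where r: "r = r1 @ w # r2" by (auto dest: split_list)
      have "successively adj ((u # v # r1 @ [w]) @ r2)"
        using p by (simp add: is_path_def p_eq r)
      then have "successively adj (u # v # r1 @ [w])"
        by (simp only: successively_append_iff)
      then have "cycle_in G (u # v # r1 @ [w])"
        using p uw by (auto simp: cycle_in_def is_path_def p_eq r adj_def insert_commute)
      then show False using acyclic by blast
    qed
  qed
  ultimately show thesis by (rule that)
qed

lemma cycle_in_mono:
  assumes "cycle_in F c" "edges F \<subseteq> edges G"
  shows "cycle_in G c"
proof -
  have "successively (\<lambda>a b. {a, b} \<in> edges G) c"
    using assms by (auto simp: cycle_in_def elim: successively_mono)
  then show ?thesis using assms by (auto simp: cycle_in_def)
qed

lemma delete_verts_delete_verts:
  "delete_verts (delete_verts H K) L = delete_verts H (K \<union> L)"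
  by (auto simp: delete_verts_def)

text \<open>The vertex that enlarges an independent set avoiding the closed neighbourhood of \<open>x\<close> can
  always be chosen to be \<open>y\<close>, since all neighbours of \<open>y\<close> lie in that closed neighbourhood.\<close>

lemma shedding_if_neighbors_subset:
  assumes y: "y \<in> neighbors H x" "y \<noteq> x"
    and sub: "neighbors H y \<subseteq> closed_neighbors H x"
    and C: "independent_in (delete_verts H (closed_neighbors H x)) C"
  shows "independent_in (delete_verts H {x}) (C \<union> {y})"
proof -
  have C_sub: "C \<subseteq> verts H - closed_neighbors H x"
    using C by (auto simp: independent_in_def delete_verts_def)
  have CC: "{c, d} \<notin> edges H" if "c \<in> C" "d \<in> C" "c \<noteq> d" for c d
    using C C_sub that by (auto simp: independent_in_def delete_verts_def indep_def)
  have yC: "{y, c} \<notin> edges H" "{c, y} \<notin> edges H" if "c \<in> C" for c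
    using C_sub sub that by (auto simp: neighbors_def insert_commute)
  have "C \<union> {y} \<subseteq> verts H - {x}"
    using y C_sub by (auto simp: neighbors_def closed_neighbors_def)
  then show ?thesis
    using CC yC by (auto simp: independent_in_def delete_verts_def indep_def)
qed

lemma in_edges_graph_expansion:
  "{(u, l), (v, m)} \<in> edges (graph_expansion t e k) \<longleftrightarrow>
     (\<exists>i\<in>{1..t}. e i = {u, v} \<and> 1 \<le> l \<and> 1 \<le> m \<and> l + m \<le> k i + 1)"
proof
  assume "{(u, l), (v, m)} \<in> edges (graph_expansion t e k)"
  then obtain i u' v' l' m' where i: "i \<in> {1..t}"
    and ends: "{(u, l), (v, m)} = {(u', l'), (v', m')}" and "e i = {u', v'}"
    and "1 \<le> l'" "1 \<le> m'" "l' + m' \<le> k i + 1"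
    by (auto simp: graph_expansion_def edge_expansion_def)
  moreover from ends have
    "u = u' \<and> l = l' \<and> v = v' \<and> m = m' \<or> u = v' \<and> l = m' \<and> v = u' \<and> m = l'"
    by (simp add: doubleton_eq_iff)
  ultimately have "e i = {u, v} \<and> 1 \<le> l \<and> 1 \<le> m \<and> l + m \<le> k i + 1" by auto
  with i show "\<exists>i\<in>{1..t}. e i = {u, v} \<and> 1 \<le> l \<and> 1 \<le> m \<and> l + m \<le> k i + 1"
    by blast
next
  assume "\<exists>i\<in>{1..t}. e i = {u, v} \<and> 1 \<le> l \<and> 1 \<le> m \<and> l + m \<le> k i + 1"
  then obtain i where i: "i \<in> {1..t}" and "e i = {u, v}"
    and "l \<in> {1..k i}" "m \<in> {1..k i}" "l + m \<le> k i + 1" by auto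
  then have "{(u, l), (v, m)} \<in> edges (edge_expansion (e i) (k i))"
    unfolding edge_expansion_def graph.simps by blast
  then show "{(u, l), (v, m)} \<in> edges (graph_expansion t e k)"
    using i by (auto simp: graph_expansion_def)
qed

lemma edges_graph_expansionE:
  assumes "d \<in> edges (graph_expansion t e k)"
  obtains u l v m where "d = {(u, l), (v, m)}"
  using assms by (auto simp: graph_expansion_def edge_expansion_def)

lemma in_verts_graph_expansion:
  "(w, l) \<in> verts (graph_expansion t e k) \<longleftrightarrow>
     (\<exists>i\<in>{1..t}. w \<in> e i \<and> 1 \<le> l \<and> l \<le> max 1 (k i))"
proof -
  have "(w, l) \<in> verts (edge_expansion d p) \<longleftrightarrow> w \<in> d \<and> 1 \<le> l \<and> l \<le> max 1 p" for d p
    by (cases "p = 0") (auto simp: edge_expansion_def)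
  then show ?thesis by (simp add: graph_expansion_def)
qed

lemma edges_subset_verts_graph_expansion:
  assumes "d \<in> edges (graph_expansion t e k)"
  shows "d \<subseteq> verts (graph_expansion t e k)"
proof -
  obtain u l v m where d: "d = {(u, l), (v, m)}"
    using assms by (rule edges_graph_expansionE)
  with assms obtain i where "i \<in> {1..t}" "e i = {u, v}" "1 \<le> l" "1 \<le> m" "l + m \<le> k i + 1"
    by (auto simp: in_edges_graph_expansion)
  then have "(u, l) \<in> verts (graph_expansion t e k)" "(v, m) \<in> verts (graph_expansion t e k)"
    unfolding in_verts_graph_expansion by (auto intro!: bexI[of _ i])
  then show ?thesis by (simp add: d)
qed

lemma finite_verts_graph_expansion:
  assumes "\<And>i. i \<in> {1..t} \<Longrightarrow> finite (e i)"
  shows "finite (verts (graph_expansion t e k))"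
  using assms by (auto simp: graph_expansion_def edge_expansion_def)

text \<open>The condition on \<open>K\<close> cannot be dropped: deleting an arbitrary set of vertices can leave a
  4-cycle, which is not vertex decomposable. It is what keeps the pendant neighbour \<open>(u, b)\<close> in the
  graph, at the level \<open>b\<close> whose only partner above \<open>v\<close> is the lowest vertex left there.\<close>

lemma vertex_decomposable_delete_initial_segments:
  fixes e :: "nat \<Rightarrow> 'a set" and k :: "nat \<Rightarrow> nat" and t :: nat
  defines "B \<equiv> graph_expansion t e k"
  assumes simple: "simple_graph G" and acyclic: "\<nexists>c. cycle_in G c"
    and inj: "inj_on e {1..t}" and e_edges: "e ` {1..t} \<subseteq> edges G"
    and down: "\<And>w l m. (w, m) \<in> K \<Longrightarrow> (w, l) \<in> verts B \<Longrightarrow> l \<le> m \<Longrightarrow> (w, l) \<in> K"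
  shows "vertex_decomposable (delete_verts B K)"
  using down
proof (induction "card (verts B - K)" arbitrary: K rule: less_induct)
  case less
  define H where "H = delete_verts B K"
  have fin: "finite (verts B)"
    unfolding B_def
  proof (rule finite_verts_graph_expansion)
    fix i assume "i \<in> {1..t}"
    then have "e i \<in> edges G" using e_edges by blast
    then show "finite (e i)"
      using simple by (auto simp: simple_graph_def intro: finite_subset)
  qed
  have verts_H: "verts H = verts B - K"
    by (simp add: H_def delete_verts_def)
  have edges_H: "{p, q} \<in> edges H \<longleftrightarrow> {p, q} \<in> edges B \<and> p \<in> verts H \<and> q \<in> verts H" for p q
    by (auto simp: H_def delete_verts_def)
  show ?case
  proof (cases "edges H = {}")
    case True
    then show ?thesis unfolding H_def by (rule no_edges)
  next
    case False
    define lifts where "lifts = (\<lambda>u v. \<exists>l m. {(u, l), (v, m)} \<in> edges H)"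
    define alive where "alive = {{u, v} | u v. {u, v} \<in> edges G \<and> lifts u v}"
    have lifts_sym: "lifts u v \<Longrightarrow> lifts v u" for u v
      unfolding lifts_def by (metis insert_commute)
    have alive_iff: "{u, v} \<in> alive \<longleftrightarrow> {u, v} \<in> edges G \<and> lifts u v" for u v
      using lifts_sym by (auto simp: alive_def doubleton_eq_iff insert_commute)
    have above: "{u, v} \<in> alive" if edge: "{(u, l), (v, m)} \<in> edges H" for u l v m
    proof -
      obtain i where "i \<in> {1..t}" "e i = {u, v}"
        using edge by (auto simp: edges_H B_def in_edges_graph_expansion)
      then have "{u, v} \<in> edges G" using e_edges by (metis imageI subsetD)
      then show ?thesis using edge by (auto simp: alive_iff lifts_def)
    qed
    \<comment> \<open>A leaf of \<open>G\<close> itself may have no edge of \<open>H\<close> above it, so the leaf is taken in the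
      subforest of alive edges.\<close>
    let ?F = "\<lparr>verts = verts G, edges = alive\<rparr>"
    have "alive \<subseteq> edges G" by (auto simp: alive_def)
    then have "simple_graph ?F" and "\<nexists>c. cycle_in ?F c"
      using simple acyclic cycle_in_mono[of ?F _ G] by (auto simp: simple_graph_def)
    moreover have "edges ?F \<noteq> {}"
    proof -
      obtain d where d: "d \<in> edges H" using False by blast
      then have "d \<in> edges B" by (simp add: H_def delete_verts_def)
      then obtain u l v m where "d = {(u, l), (v, m)}"
        unfolding B_def by (rule edges_graph_expansionE)
      then show ?thesis using above d by fastforce
    qed
    ultimately obtain u v where uv: "{u, v} \<in> alive"
      and leaf: "\<And>w. {u, w} \<in> alive \<Longrightarrow> w = v"
      by (rule acyclic_graph_has_leaf) auto
    from uv obtain l m where lm: "{(u, l), (v, m)} \<in> edges H"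
      by (auto simp: alive_iff lifts_def)
    then obtain i where i: "i \<in> {1..t}" "e i = {u, v}" "1 \<le> l" "1 \<le> m" "l + m \<le> k i + 1"
      by (auto simp: edges_H B_def in_edges_graph_expansion)
    have "u \<noteq> v"
    proof
      assume "u = v"
      then have "{v} \<in> edges G" using uv \<open>alive \<subseteq> edges G\<close> by auto
      then show False using simple by (fastforce simp: simple_graph_def)
    qed
    define a where "a = (LEAST a. (v, a) \<in> verts H)"
    have a: "(v, a) \<in> verts H" and a_le: "\<And>c. (v, c) \<in> verts H \<Longrightarrow> a \<le> c"
      unfolding a_def using lm by (auto simp: edges_H intro: LeastI Least_le)
    have a_pos: "1 \<le> a"
      using a by (auto simp: verts_H B_def in_verts_graph_expansion)
    have "a \<le> m" using a_le lm by (simp add: edges_H)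
    \<comment> \<open>The highest level above \<open>u\<close> that is still adjacent to \<open>(v, a)\<close>.\<close>
    define b where "b = k i + 1 - a"
    have b: "l \<le> b" "b \<le> k i" "a + b = k i + 1"
      using i a_pos \<open>a \<le> m\<close> by (auto simp: b_def)
    let ?x = "(v, a)" and ?y = "(u, b)"
    have y_B: "?y \<in> verts B"
      unfolding B_def in_verts_graph_expansion using i b by (intro bexI[of _ i]) auto
    have y_H: "?y \<in> verts H"
    proof -
      have "(u, l) \<in> verts B" "(u, l) \<notin> K" using lm by (auto simp: edges_H verts_H)
      then have "?y \<notin> K" using less.prems b(1) by blast
      then show ?thesis using y_B by (simp add: verts_H)
    qed
    have "{?x, ?y} \<in> edges B"
      unfolding B_def in_edges_graph_expansion
      using i b a_pos by (intro bexI[of _ i]) auto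
    then have y_nbr: "?y \<in> neighbors H ?x"
      using a y_H by (auto simp: neighbors_def edges_H)
    have y_pendant: "neighbors H ?y \<subseteq> {?x}"
    proof
      fix z assume z: "z \<in> neighbors H ?y"
      obtain w c where z_eq: "z = (w, c)" by (cases z)
      have wc: "{(u, b), (w, c)} \<in> edges H" using z by (simp add: neighbors_def z_eq)
      have "w = v" using above[OF wc] by (rule leaf)
      with wc obtain j where "j \<in> {1..t}" "e j = {u, v}" "b + c \<le> k j + 1"
        by (auto simp: edges_H B_def in_edges_graph_expansion)
      moreover from this have "j = i" using inj i(1,2) by (metis inj_onD)
      ultimately have "c \<le> a" using b(3) by simp
      moreover have "a \<le> c" using wc \<open>w = v\<close> by (simp add: a_le edges_H)
      ultimately show "z \<in> {?x}" using \<open>w = v\<close> by (simp add: z_eq)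
    qed
    have recurse: "vertex_decomposable (delete_verts H L)"
      if x_L: "?x \<in> L"
        and down_L: "\<And>w l m. (w, m) \<in> L \<Longrightarrow> (w, l) \<in> verts H \<Longrightarrow> l \<le> m \<Longrightarrow> (w, l) \<in> L" for L
      unfolding H_def delete_verts_delete_verts
    proof (rule less.hyps)
      have "verts B - (K \<union> L) \<subset> verts B - K"
        using a x_L by (auto simp: verts_H)
      then show "card (verts B - (K \<union> L)) < card (verts B - K)"
        using fin by (intro psubset_card_mono) auto
      show "(w, l) \<in> K \<union> L" if "(w, m) \<in> K \<union> L" "(w, l) \<in> verts B" "l \<le> m" for w l m
      proof (cases "(w, l) \<in> K")
        case False
        then have "(w, m) \<in> L" using that less.prems by blast
        then show ?thesis using down_L that False by (simp add: verts_H)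
      qed simp
    qed
    have "vertex_decomposable (delete_verts H {?x})"
      using a_le by (intro recurse) (auto intro: antisym)
    moreover have "vertex_decomposable (delete_verts H (closed_neighbors H ?x))"
    proof (rule recurse)
      show "?x \<in> closed_neighbors H ?x" by (simp add: closed_neighbors_def)
      fix w l m
      assume wm: "(w, m) \<in> closed_neighbors H ?x" and wl: "(w, l) \<in> verts H" and "l \<le> m"
      show "(w, l) \<in> closed_neighbors H ?x"
      proof (cases "(w, m) = ?x")
        case True
        then have "(w, l) = ?x" using a_le[of l] wl \<open>l \<le> m\<close> by simp
        then show ?thesis by (simp add: closed_neighbors_def)
      next
        case False
        then have "{?x, (w, m)} \<in> edges H"
          using wm by (auto simp: closed_neighbors_def neighbors_def)
        then obtain j where "j \<in> {1..t}" "e j = {v, w}" "a + m \<le> k j + 1"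
          by (auto simp: edges_H B_def in_edges_graph_expansion)
        moreover have "1 \<le> l" using wl by (auto simp: verts_H B_def in_verts_graph_expansion)
        ultimately have "{?x, (w, l)} \<in> edges B"
          unfolding B_def in_edges_graph_expansion
          using a_pos \<open>l \<le> m\<close> by (intro bexI[of _ j]) auto
        then show ?thesis
          using a wl by (simp add: closed_neighbors_def neighbors_def edges_H)
      qed
    qed
    moreover have "\<forall>C. independent_in (delete_verts H (closed_neighbors H ?x)) C \<longrightarrow>
        (\<exists>y\<in>neighbors H ?x. independent_in (delete_verts H {?x}) (C \<union> {y}))"
      using shedding_if_neighbors_subset[OF y_nbr] y_nbr y_pendant \<open>u \<noteq> v\<close>
      by (auto simp: closed_neighbors_def)
    ultimately show ?thesis
      using shedding[OF a] by (simp add: H_def)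
  qed
qed

theorem theorem3p3:
  fixes G :: "'a graph" and n :: nat and x :: "nat \<Rightarrow> 'a"
    and e :: "nat \<Rightarrow> 'a set" and k :: "nat \<Rightarrow> nat"
  assumes "tree G"
    and "bij_betw x {1..n} (verts G)"
    and "bij_betw e {1..n - 1} (edges G)"
  shows "vertex_decomposable (graph_expansion (n - 1) e k)"
proof -
  have G: "simple_graph G" "\<nexists>c. cycle_in G c"
    using assms(1) unfolding tree_def by blast+
  have "d \<subseteq> verts (graph_expansion (n - 1) e k)"
    if "d \<in> edges (graph_expansion (n - 1) e k)" for d
    using that by (rule edges_subset_verts_graph_expansion)
  then have "delete_verts (graph_expansion (n - 1) e k) {} = graph_expansion (n - 1) e k"
    by (intro graph.equality) (auto simp: delete_verts_def)
  then show ?thesis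
    using vertex_decomposable_delete_initial_segments[OF G, of e "n - 1" "{}" k] assms(3)
    by (simp add: bij_betw_def)
qed

end
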